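(* Fix $x_t\in\mathbf{R}^d$ and $\zeta$, let $\varepsilon>0$, $\tilde\varepsilon=\varepsilon/G$, $K'=M(\lambda\beta)^{-1}$, $R_2=2M^2(\lambda\beta)^{-2}(\sigma^2+\lambda^2\delta^2)$, and $\widehat\Delta=\sup_\zeta\{\mathcal{L}_\zeta(x_t,\eta^0)-\Psi_\zeta(x_t)\}$. Apply the inner SGD algorithm to $\min_{\eta\in\mathbf{R}}\mathcal{L}_\zeta(x_t,\eta)$ with learning rate $\alpha_d=\min\{\frac1{K'},\frac{\tilde\varepsilon^2}{R_2K'}\}$ and batch size $\tilde B=1$. Then it outputs an $\eta_{x_t}^{\tilde d}(\zeta)$ satisfying $$\mathbb{E}_{\eta_{x_t}^{\tilde d}(\zeta)}\big|\nabla_2\mathcal{L}_\zeta(x_t,\eta_{x_t}^{\tilde d}(\zeta))\big|^2\le\tilde\varepsilon^2 .$$ In particular, it takes $D=\mathcal{O}(\widehat\Delta K'R_2\tilde\varepsilon^{-4})=\mathcal{O}(\widehat\Delta K'R_2G^4\varepsilon^{-4})$ iterations to obtain such an $\tilde\varepsilon$-stationary point, and the stochastic gradient oracle complexity is $\mathcal{O}(\widehat\Delta K'R_2G^4\varepsilon^{-4})$.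
   Context: Setting. $\mathbb{P}$ is the nominal distribution of $\zeta$ on a sample space $\Omega$, $\nu$ is a reference probability measure on $\Omega$ from which $\xi$ is sampled, $\lambda,\beta>0$, $\ell(x;\xi)$ is a real-valued loss ($x\in\mathbf{R}^d$, $\xi\in\Omega$), $c:\Omega\times\Omega\to\mathbf{R}$ is a cost. The function $f:[0,\infty)\to[-\infty,+\infty]$ is convex with $f(1)=0$ and $f(0)=\lim_{t\to0+}f(t)$, with conjugate $f^*(v)=\sup_{r\ge0}\{vr-f(r)\}$. Define $$\mathcal{L}_\zeta(x,\eta)=\mathbb{E}_{\xi\sim\nu}\Big[\lambda\beta f^*\Big(\frac{\ell(x;\xi)-\lambda c(\zeta,\xi)-\eta}{\lambda\beta}\Big)\Big]+\eta,\qquad \Psi_\zeta(x)=\min_{\eta\in\mathbf{R}}\mathcal{L}_\zeta(x,\eta).$$ $\nabla_2$ denotes the derivative in $\eta$, given by $\nabla_2\mathcal{L}_\zeta(x,\eta)=1-\mathbb{E}_{\xi\sim\nu}[(f^* )'((\ell(x;\xi)-\lambda c(\zeta,\xi)-\eta)/(\lambda\beta))]$. Inner SGD algorithm (Algorithm 1). Input: initialization $\eta^0\in\mathbf{R}$, sample $\zeta$, number of iterations $D$, batch size $\tilde B$, step sizes $\alpha_d$. Set $\eta^0_{x_t}(\zeta)=\eta^0$. For $d=0,\dots,D-1$: draw fresh i.i.d. $\xi_1,\dots,\xi_{\tilde B}\sim\nu$, compute $$v^{\tilde B}(\eta)=1-\frac1{\tilde B}\sum_{i=1}^{\tilde B}(f^*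 )'\Big(\frac{\ell(x_t;\xi_i)-\lambda c(\zeta,\xi_i)-\eta}{\lambda\beta}\Big)$$ at $\eta=\eta_{x_t}^d(\zeta)$, and set $\eta_{x_t}^{d+1}(\zeta)=\eta_{x_t}^d(\zeta)-\alpha_d v^{\tilde B}(\eta_{x_t}^d(\zeta))$. Output $\eta_{x_t}^{\tilde d}(\zeta)$ with $\tilde d$ uniform on $\{0,\dots,D-1\}$. $\mathbb{E}_{\eta_{x_t}^{\tilde d}(\zeta)}$ is expectation over all the randomness of this output. The stochastic gradient oracle complexity is the total number of sampled stochastic gradients. $\mathcal{O}(\cdot)$ is understood as the target error tends to $0$, hiding absolute constants. Assumption 1: for every $\xi$, $\ell(\cdot;\xi)$ is $G$-Lipschitz, continuously differentiable and $L$-smooth; $f^*$ is continuously differentiable and $M$-smooth (derivative $M$-Lipschitz); $x\mapsto\mathbb{E}_{\zeta\sim\mathbb{P}}[\Psi_\zeta(x)]$ is bounded below. Assumption 2: there exist $\sigma,\delta>0$ such that $\mathrm{Var}_\xi(\ell(x;\xi))\le\sigma^2$ for every $x$; $\mathrm{Var}_\xi(c(\zeta,\xi))\le\delta^2$ for every $\zeta$; and $\mathrm{Var}_\zeta(c(\zeta,\xi))\le\delta^2$ for every $\xi$. (Variances over $\xi$ are with respect to $\nu$, over $\zeta$ with respect to $\mathbb{P}$.)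
   Formalization: The accuracy claim excludes the single value ε̃² = R₂, where it can fail for every D; the iteration and oracle bounds read max(1, ·) since D ≥ 1; the absolute constant is formally chosen for each dimension and sample-space type. *)

theory Defs
  imports "HOL-Probability.Probability"
begin

(* Only the values of f on [0, infinity) matter: f is a function on that half-line. *)

definition conjugate :: "(real \<Rightarrow> ereal) \<Rightarrow> real \<Rightarrow> ereal" where
  "conjugate f v = (SUP r\<in>{0..}. ereal (v * r) - f r)"

definition fstar :: "(real \<Rightarrow> ereal) \<Rightarrow> real \<Rightarrow> real" where
  "fstar f v = real_of_ereal (conjugate f v)"

definition dual_obj ::
  "'a measure \<Rightarrow> real \<Rightarrow> real \<Rightarrow> ('x \<Rightarrow> 'a \<Rightarrow> real) \<Rightarrow> ('a \<Rightarrow> 'a \<Rightarrow> real) \<Rightarrow> (real \<Rightarrow> ereal)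
     \<Rightarrow> 'a \<Rightarrow> 'x \<Rightarrow> real \<Rightarrow> real" where
  "dual_obj \<nu> lam \<beta> l c f \<zeta> x \<eta> =
     (\<integral>\<xi>. lam * \<beta> * fstar f ((l x \<xi> - lam * c \<zeta> \<xi> - \<eta>) / (lam * \<beta>)) \<partial>\<nu>) + \<eta>"

(* An infimum, which is the minimum whenever the minimum is attained. It is finite in the setting
   below, because f 1 = 0 gives fstar f v \<ge> v. *)
definition Psi ::
  "'a measure \<Rightarrow> real \<Rightarrow> real \<Rightarrow> ('x \<Rightarrow> 'a \<Rightarrow> real) \<Rightarrow> ('a \<Rightarrow> 'a \<Rightarrow> real) \<Rightarrow> (real \<Rightarrow> ereal)
     \<Rightarrow> 'a \<Rightarrow> 'x \<Rightarrow> real" where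
  "Psi \<nu> lam \<beta> l c f \<zeta> x = (INF \<eta>. dual_obj \<nu> lam \<beta> l c f \<zeta> x \<eta>)"

(* On a probability space, square integrability also gives integrability of X, so the variance
   below is the actual one and not a default value of the integral. *)
definition variance_le :: "'a measure \<Rightarrow> ('a \<Rightarrow> real) \<Rightarrow> real \<Rightarrow> bool" where
  "variance_le N X s \<longleftrightarrow>
     X \<in> borel_measurable N \<and> integrable N (\<lambda>\<omega>. (X \<omega>)\<^sup>2) \<and> prob_space.variance N X \<le> s"

(* Convexity is stated by the epigraph because f may take both infinite values. *)
locale dro_setting =
  P: prob_space P + nu: prob_space \<nu>
  for P \<nu> :: "'a measure" +
  fixes lam \<beta> :: real
    and l :: "real ^ 'd \<Rightarrow> 'a \<Rightarrow> real"
    and c :: "'a \<Rightarrow> 'a \<Rightarrow> real"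
    and f :: "real \<Rightarrow> ereal"
    and G L M \<sigma> \<delta> :: real
  assumes sets_eq: "sets P = sets \<nu>"
    and pos: "lam > 0" "\<beta> > 0" "G > 0" "M > 0" "\<sigma> > 0" "\<delta> > 0"
    and f_convex: "convex {(t, y :: real). 0 \<le> t \<and> f t \<le> ereal y}"
    and f_one: "f 1 = 0"
    and f_zero: "(f \<longlongrightarrow> f 0) (at_right 0)"
    and loss_Lipschitz: "\<And>\<xi>. \<xi> \<in> space \<nu> \<Longrightarrow> G-lipschitz_on UNIV (\<lambda>x. l x \<xi>)"
    and loss_smooth: "\<And>\<xi>. \<xi> \<in> space \<nu> \<Longrightarrow>
      \<exists>g. (\<forall>x. GDERIV (\<lambda>x. l x \<xi>) x :> g x) \<and> continuous_on UNIV g \<and> L-lipschitz_on UNIV g"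
    and conjugate_finite: "\<And>v. \<bar>conjugate f v\<bar> \<noteq> \<infinity>"
    and fstar_differentiable: "\<And>v. fstar f differentiable (at v)"
    and fstar_C1: "continuous_on UNIV (deriv (fstar f))"
    and fstar_smooth: "M-lipschitz_on UNIV (deriv (fstar f))"
    and Psi_integrable: "\<And>x. integrable P (\<lambda>\<zeta>. Psi \<nu> lam \<beta> l c f \<zeta> x)"
    and Psi_bounded_below: "bdd_below (range (\<lambda>x. \<integral>\<zeta>. Psi \<nu> lam \<beta> l c f \<zeta> x \<partial>P))"
    and loss_variance: "\<And>x. variance_le \<nu> (\<lambda>\<xi>. l x \<xi>) (\<sigma>\<^sup>2)"
    and cost_variance_xi: "\<And>\<zeta>. \<zeta> \<in> space \<nu> \<Longrightarrow> variance_le \<nu> (\<lambda>\<xi>. c \<zeta> \<xi>) (\<delta>\<^sup>2)"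
    and cost_variance_zeta: "\<And>\<xi>. \<xi> \<in> space \<nu> \<Longrightarrow> variance_le P (\<lambda>\<zeta>. c \<zeta> \<xi>) (\<delta>\<^sup>2)"

definition Delta_hat ::
  "'a measure \<Rightarrow> real \<Rightarrow> real \<Rightarrow> ('x \<Rightarrow> 'a \<Rightarrow> real) \<Rightarrow> ('a \<Rightarrow> 'a \<Rightarrow> real) \<Rightarrow> (real \<Rightarrow> ereal)
     \<Rightarrow> 'x \<Rightarrow> real \<Rightarrow> ereal" where
  "Delta_hat \<nu> lam \<beta> l c f x \<eta>0 =
     (SUP \<zeta>\<in>space \<nu>. ereal (dual_obj \<nu> lam \<beta> l c f \<zeta> x \<eta>0 - Psi \<nu> lam \<beta> l c f \<zeta> x))"

definition batch_grad ::
  "real \<Rightarrow> real \<Rightarrow> ('x \<Rightarrow> 'a \<Rightarrow> real) \<Rightarrow> ('a \<Rightarrow> 'a \<Rightarrow> real) \<Rightarrow> (real \<Rightarrow> ereal)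
     \<Rightarrow> 'x \<Rightarrow> 'a \<Rightarrow> nat \<Rightarrow> (nat \<Rightarrow> 'a) \<Rightarrow> real \<Rightarrow> real" where
  "batch_grad lam \<beta> l c f x \<zeta> B s \<eta> =
     1 - (1 / real B) *
       (\<Sum>i<B. deriv (fstar f) ((l x (s i) - lam * c \<zeta> (s i) - \<eta>) / (lam * \<beta>)))"

(* The sample \<omega> (d, i) is the i-th draw of iteration d. *)
primrec inner_iterate ::
  "real \<Rightarrow> real \<Rightarrow> ('x \<Rightarrow> 'a \<Rightarrow> real) \<Rightarrow> ('a \<Rightarrow> 'a \<Rightarrow> real) \<Rightarrow> (real \<Rightarrow> ereal)
     \<Rightarrow> 'x \<Rightarrow> 'a \<Rightarrow> real \<Rightarrow> (nat \<Rightarrow> real) \<Rightarrow> nat \<Rightarrow> (nat \<times> nat \<Rightarrow> 'a) \<Rightarrow> nat \<Rightarrow> real" where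
  "inner_iterate lam \<beta> l c f x \<zeta> \<eta>0 \<alpha> B \<omega> 0 = \<eta>0"
| "inner_iterate lam \<beta> l c f x \<zeta> \<eta>0 \<alpha> B \<omega> (Suc d) =
     inner_iterate lam \<beta> l c f x \<zeta> \<eta>0 \<alpha> B \<omega> d
     - \<alpha> d * batch_grad lam \<beta> l c f x \<zeta> B (\<lambda>i. \<omega> (d, i))
                 (inner_iterate lam \<beta> l c f x \<zeta> \<eta>0 \<alpha> B \<omega> d)"

definition draws :: "nat \<Rightarrow> nat \<Rightarrow> (nat \<times> nat) set" where
  "draws D B = {..<D} \<times> {..<B}"

(* Each draw yields one sampled stochastic gradient. *)
definition oracle_complexity :: "nat \<Rightarrow> nat \<Rightarrow> nat" where
  "oracle_complexity D B = card (draws D B)"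

(* The law of the output: all draws are i.i.d. with law \<nu>, and the output index is uniform on
   {..<D} and independent of the draws. *)
definition inner_sgd ::
  "'a measure \<Rightarrow> real \<Rightarrow> real \<Rightarrow> ('x \<Rightarrow> 'a \<Rightarrow> real) \<Rightarrow> ('a \<Rightarrow> 'a \<Rightarrow> real) \<Rightarrow> (real \<Rightarrow> ereal)
     \<Rightarrow> 'x \<Rightarrow> 'a \<Rightarrow> real \<Rightarrow> (nat \<Rightarrow> real) \<Rightarrow> nat \<Rightarrow> nat \<Rightarrow> real measure" where
  "inner_sgd \<nu> lam \<beta> l c f x \<zeta> \<eta>0 \<alpha> B D =
     distr ((\<Pi>\<^sub>M j\<in>draws D B. \<nu>) \<Otimes>\<^sub>M uniform_count_measure {..<D}) borel
       (\<lambda>(\<omega>, d). inner_iterate lam \<beta> l c f x \<zeta> \<eta>0 \<alpha> B \<omega> d)"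

definition expected_sq_grad ::
  "'a measure \<Rightarrow> real \<Rightarrow> real \<Rightarrow> ('x \<Rightarrow> 'a \<Rightarrow> real) \<Rightarrow> ('a \<Rightarrow> 'a \<Rightarrow> real) \<Rightarrow> (real \<Rightarrow> ereal)
     \<Rightarrow> 'x \<Rightarrow> 'a \<Rightarrow> real \<Rightarrow> (nat \<Rightarrow> real) \<Rightarrow> nat \<Rightarrow> nat \<Rightarrow> ennreal" where
  "expected_sq_grad \<nu> lam \<beta> l c f x \<zeta> \<eta>0 \<alpha> B D =
     (\<integral>\<^sup>+ \<eta>. ennreal (\<bar>deriv (dual_obj \<nu> lam \<beta> l c f \<zeta> x) \<eta>\<bar>\<^sup>2)
        \<partial>inner_sgd \<nu> lam \<beta> l c f x \<zeta> \<eta>0 \<alpha> B D)"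

end

theory Submission
  imports Defs
begin

text \<open>
  Fix \<open>x\<close> and \<open>\<zeta>\<close>, put \<open>X = l x - lam * c \<zeta>\<close> and \<open>\<kappa> = lam * \<beta>\<close>, and let \<open>F\<close> be the dual
  objective as a function of \<open>\<eta>\<close>. Two facts about \<open>F\<close> carry the proof. It is smooth with constant
  \<open>K = M / \<kappa>\<close> (\<open>risk_remainder\<close>), and the sampled derivative
  \<open>1 - (f\<^sup>*)' ((X - \<eta>) / \<kappa>)\<close> is unbiased with variance at most
  \<open>R = 2 * M\<^sup>2 / \<kappa>\<^sup>2 * (\<sigma>\<^sup>2 + lam\<^sup>2 * \<delta>\<^sup>2)\<close>, because \<open>(f\<^sup>*)'\<close> is \<open>M\<close>-Lipschitz
  (\<open>variance_sample_grad\<close>, \<open>variance_diff_scaled_le\<close>). The rest is the standard argument for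
  stochastic gradient descent on a smooth function that is bounded below (\<open>fstar_ge\<close>,
  \<open>risk_ge_expectation\<close>).

  A step of size \<open>\<alpha> \<le> 1 / K\<close> satisfies
  \<open>E F(\<eta>') \<le> F(\<eta>) - \<alpha> * (1 - K * \<alpha> / 2) * F'(\<eta>)\<^sup>2 + K * \<alpha>\<^sup>2 * R / 2\<close> (\<open>sgd_step_drift\<close>). Since
  every step uses a fresh sample, this telescopes along the trajectory (\<open>drift_sum\<close>), and the
  uniform output index turns the sum of the squared derivatives into their average. With
  \<open>gap = F(\<eta>\<^sub>0) - inf F\<close> the averaged squared derivative is therefore at most \<open>e\<close> as soon as
  \<open>gap / D + K * \<alpha>\<^sup>2 * R / 2 \<le> \<alpha> * (1 - K * \<alpha> / 2) * e\<close> (\<open>expected_sq_grad_le\<close>).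

  For \<open>\<alpha> = min (1 / K) (e / (R * K))\<close> and \<open>e \<noteq> R\<close> this inequality is strict without the term
  \<open>gap / D\<close>, so it holds for large \<open>D\<close>. For \<open>e \<le> R / 2\<close> at least
  \<open>e\<^sup>2 / (4 * K * R)\<close> is left for \<open>gap / D\<close>, and \<open>D \<ge> 4 * gap * K * R / e\<^sup>2\<close> is enough. Rounding
  up to an integer doubles the constant to 8.
\<close>

section \<open>Functions of one real variable with Lipschitz derivative\<close>

text \<open>Along the segment from \<open>v\<close> to \<open>v + u\<close> the remainder has derivative at most
  \<open>M * u\<^sup>2 * t\<close>, so the comparison with \<open>M * u\<^sup>2 * t\<^sup>2 / 2\<close> is monotone. The factor one half is
  needed: with a weaker constant a step of size one over the smoothness constant would not be
  guaranteed to decrease the objective.\<close>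

lemma lipschitz_derivative_upper_bound:
  fixes \<phi> \<phi>' :: "real \<Rightarrow> real"
  assumes der: "\<And>v. (\<phi> has_real_derivative \<phi>' v) (at v)"
    and lip: "M-lipschitz_on UNIV \<phi>'"
  shows "\<phi> (v + u) - \<phi> v - u * \<phi>' v \<le> M * u\<^sup>2 / 2"
proof -
  define k where "k t = \<phi> (v + t * u) - t * u * \<phi>' v - M * u\<^sup>2 * t\<^sup>2 / 2" for t
  have "k 1 \<le> k 0"
  proof (rule DERIV_nonpos_imp_nonincreasing[of 0 1 k])
    fix t :: real assume t: "0 \<le> t" "t \<le> 1"
    have "(k has_real_derivative (\<phi>' (v + t * u) * u - u * \<phi>' v - M * u\<^sup>2 * t)) (at t)"
      unfolding k_def by (auto intro!: derivative_eq_intros DERIV_chain2[OF der])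
    moreover have "\<phi>' (v + t * u) * u - u * \<phi>' v \<le> M * u\<^sup>2 * t"
    proof -
      have "\<bar>\<phi>' (v + t * u) - \<phi>' v\<bar> \<le> M * \<bar>t * u\<bar>"
        using lipschitz_onD[OF lip, of "v + t * u" v] by (simp add: dist_real_def)
      then have "\<bar>u\<bar> * \<bar>\<phi>' (v + t * u) - \<phi>' v\<bar> \<le> \<bar>u\<bar> * (M * \<bar>t * u\<bar>)"
        by (rule mult_left_mono) simp
      moreover have "u * (\<phi>' (v + t * u) - \<phi>' v) \<le> \<bar>u\<bar> * \<bar>\<phi>' (v + t * u) - \<phi>' v\<bar>"
        by (metis abs_ge_self abs_mult)
      moreover have "\<bar>u\<bar> * (M * \<bar>t * u\<bar>) = M * u\<^sup>2 * t"
        using t by (simp add: abs_mult power2_eq_square)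
      ultimately have "u * (\<phi>' (v + t * u) - \<phi>' v) \<le> M * u\<^sup>2 * t" by linarith
      then show ?thesis by (simp add: algebra_simps)
    qed
    ultimately show "\<exists>y. (k has_real_derivative y) (at t) \<and> y \<le> 0"
      by (intro exI[of _ "\<phi>' (v + t * u) * u - u * \<phi>' v - M * u\<^sup>2 * t"]) auto
  qed simp
  then show ?thesis by (simp add: k_def algebra_simps)
qed

lemma lipschitz_derivative_abs_bound:
  fixes \<phi> \<phi>' :: "real \<Rightarrow> real"
  assumes der: "\<And>v. (\<phi> has_real_derivative \<phi>' v) (at v)"
    and lip: "M-lipschitz_on UNIV \<phi>'"
  shows "\<bar>\<phi> (v + u) - \<phi> v - u * \<phi>' v\<bar> \<le> M * u\<^sup>2 / 2"
proof -
  have "((\<lambda>v. - \<phi> v) has_real_derivative - \<phi>' w) (at w)" for w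
    by (intro DERIV_minus der)
  moreover have "M-lipschitz_on UNIV (\<lambda>v. - \<phi>' v)"
    using lip by simp
  ultimately have "- \<phi> (v + u) - - \<phi> v - u * (- \<phi>' v) \<le> M * u\<^sup>2 / 2"
    by (rule lipschitz_derivative_upper_bound[of "\<lambda>v. - \<phi> v"])
  then show ?thesis
    using lipschitz_derivative_upper_bound[OF assms, of v u] by linarith
qed

text \<open>The converse direction: a quadratic remainder bound identifies the derivative. It replaces
  differentiation under the integral sign, because such a bound survives integration.\<close>

lemma quadratic_remainder_imp_DERIV:
  fixes F :: "real \<Rightarrow> real"
  assumes "\<And>h. \<bar>F (x + h) - F x - h * m\<bar> \<le> K * h\<^sup>2"
  shows "(F has_real_derivative m) (at x)"
proof -
  have "(\<lambda>h. (F (x + h) - F x) / h - m) \<midarrow>0\<rightarrow> 0"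
  proof (rule Lim_null_comparison)
    show "\<forall>\<^sub>F h in at 0. norm ((F (x + h) - F x) / h - m) \<le> K * \<bar>h\<bar>"
      unfolding eventually_at_filter
    proof (intro always_eventually allI impI)
      fix h :: real assume h: "h \<noteq> 0"
      have "norm ((F (x + h) - F x) / h - m) = \<bar>F (x + h) - F x - h * m\<bar> / \<bar>h\<bar>"
        using h by (simp add: field_simps flip: abs_divide)
      also have "\<dots> \<le> K * h\<^sup>2 / \<bar>h\<bar>"
        by (intro divide_right_mono assms) simp
      also have "\<dots> = K * \<bar>h\<bar>"
        using h by (simp add: power2_eq_square abs_if)
      finally show "norm ((F (x + h) - F x) / h - m) \<le> K * \<bar>h\<bar>" .
    qed
    show "((\<lambda>h. K * \<bar>h\<bar>) \<longlongrightarrow> 0) (at 0)"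
      by (auto intro!: tendsto_eq_intros)
  qed
  then show ?thesis
    unfolding DERIV_def by (simp add: LIM_zero_iff)
qed

section \<open>Variances\<close>

lemma (in prob_space) variance_le_second_moment_about:
  fixes X :: "'a \<Rightarrow> real"
  assumes "integrable M X" "integrable M (\<lambda>x. (X x)\<^sup>2)"
  shows "variance X \<le> expectation (\<lambda>x. (X x - a)\<^sup>2)"
proof -
  have "expectation (\<lambda>x. (X x - a)\<^sup>2)
      = expectation (\<lambda>x. (X x)\<^sup>2) - 2 * a * expectation X + a\<^sup>2"
    using assms by (simp add: power2_diff prob_space mult_ac)
  also have "\<dots> = variance X + (expectation X - a)\<^sup>2"
    using assms by (simp add: variance_eq) (simp add: power2_eq_square algebra_simps)
  finally show ?thesis by simp
qed

text \<open>The two variables may be correlated, so the factor two comes from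
  \<open>(x - t * y)\<^sup>2 \<le> 2 * x\<^sup>2 + 2 * t\<^sup>2 * y\<^sup>2\<close>; it is the factor two in the constant \<open>R\<close>.\<close>

lemma (in prob_space) variance_diff_scaled_le:
  fixes X Y :: "'a \<Rightarrow> real"
  assumes X: "X \<in> borel_measurable M" "integrable M (\<lambda>x. (X x)\<^sup>2)"
    and Y: "Y \<in> borel_measurable M" "integrable M (\<lambda>x. (Y x)\<^sup>2)"
  shows "integrable M (\<lambda>x. (X x - t * Y x)\<^sup>2)"
    and "variance (\<lambda>x. X x - t * Y x) \<le> 2 * (variance X + t\<^sup>2 * variance Y)"
proof -
  have iX: "integrable M X" and iY: "integrable M Y"
    using X Y square_integrable_imp_integrable by blast+
  have bound: "(x - t * y)\<^sup>2 \<le> 2 * x\<^sup>2 + 2 * t\<^sup>2 * y\<^sup>2" for x y :: real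
    using zero_le_power2[of "x + t * y"] by (simp add: power2_sum power2_diff power_mult_distrib)
  show "integrable M (\<lambda>x. (X x - t * Y x)\<^sup>2)"
  proof (rule Bochner_Integration.integrable_bound)
    show "integrable M (\<lambda>x. 2 * (X x)\<^sup>2 + 2 * t\<^sup>2 * (Y x)\<^sup>2)"
      using X Y by simp
    show "AE x in M. norm ((X x - t * Y x)\<^sup>2) \<le> norm (2 * (X x)\<^sup>2 + 2 * t\<^sup>2 * (Y x)\<^sup>2)"
      using bound by (intro AE_I2) simp
  qed (use X Y in measurable)
  have iXc: "integrable M (\<lambda>x. (X x - expectation X)\<^sup>2)"
   and iYc: "integrable M (\<lambda>x. (Y x - expectation Y)\<^sup>2)"
    using X Y iX iY by (simp_all add: power2_diff)
  have "variance (\<lambda>x. X x - t * Y x)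
      = expectation (\<lambda>x. ((X x - expectation X) - t * (Y x - expectation Y))\<^sup>2)"
    using iX iY by (simp add: algebra_simps)
  also have "\<dots> \<le> expectation (\<lambda>x. 2 * (X x - expectation X)\<^sup>2
                                  + 2 * t\<^sup>2 * (Y x - expectation Y)\<^sup>2)"
    by (rule integral_mono') (use iXc iYc bound in auto)
  also have "\<dots> = 2 * (variance X + t\<^sup>2 * variance Y)"
    using iXc iYc by (simp add: algebra_simps)
  finally show "variance (\<lambda>x. X x - t * Y x) \<le> 2 * (variance X + t\<^sup>2 * variance Y)" .
qed

section \<open>The dual objective as a function of its scalar variable\<close>

text \<open>The dual objective depends on the loss and the cost only through the single random variable
  \<open>X = l x - lam * c \<zeta>\<close>, and on \<open>f\<close> only through its conjugate \<open>\<phi>\<close>.\<close>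

locale shifted_risk = prob_space N for N :: "'a measure" +
  fixes \<phi> \<phi>' :: "real \<Rightarrow> real" and M \<kappa> :: real and X :: "'a \<Rightarrow> real"
  assumes \<kappa>_pos: "\<kappa> > 0"
    and DERIV_\<phi>: "\<And>v. (\<phi> has_real_derivative \<phi>' v) (at v)"
    and lipschitz_\<phi>': "M-lipschitz_on UNIV \<phi>'"
    and X_measurable [measurable]: "X \<in> borel_measurable N"
    and X_square_integrable: "integrable N (\<lambda>\<xi>. (X \<xi>)\<^sup>2)"
begin

definition risk :: "real \<Rightarrow> real" where
  "risk \<eta> = (\<integral>\<xi>. \<kappa> * \<phi> ((X \<xi> - \<eta>) / \<kappa>) \<partial>N) + \<eta>"

definition sample_grad :: "real \<Rightarrow> 'a \<Rightarrow> real" where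
  "sample_grad \<eta> \<xi> = 1 - \<phi>' ((X \<xi> - \<eta>) / \<kappa>)"

definition risk_grad :: "real \<Rightarrow> real" where
  "risk_grad \<eta> = (\<integral>\<xi>. sample_grad \<eta> \<xi> \<partial>N)"

lemma \<phi>_measurable [measurable]: "\<phi> \<in> borel_measurable borel"
  by (intro borel_measurable_continuous_onI continuous_at_imp_continuous_on ballI
        DERIV_isCont[OF DERIV_\<phi>])

lemma \<phi>'_measurable [measurable]: "\<phi>' \<in> borel_measurable borel"
  by (intro borel_measurable_continuous_onI lipschitz_on_continuous_on[OF lipschitz_\<phi>'])

lemma sample_grad_measurable [measurable]:
  "case_prod sample_grad \<in> borel_measurable (borel \<Otimes>\<^sub>M N)"
  unfolding sample_grad_def by measurable

lemma sample_grad_measurable_sample [measurable]: "sample_grad \<eta> \<in> borel_measurable N"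
  unfolding sample_grad_def[abs_def] by measurable

lemma risk_grad_measurable [measurable]: "risk_grad \<in> borel_measurable borel"
  unfolding risk_grad_def[abs_def] by measurable

lemma risk_measurable [measurable]: "risk \<in> borel_measurable borel"
  unfolding risk_def[abs_def] by measurable

lemma X_integrable: "integrable N X"
  using X_square_integrable by (rule square_integrable_imp_integrable[OF X_measurable])

lemma argument_square_integrable: "integrable N (\<lambda>\<xi>. ((X \<xi> - \<eta>) / \<kappa>)\<^sup>2)"
  using X_square_integrable X_integrable by (simp add: power_divide power2_diff)

lemma argument_integrable: "integrable N (\<lambda>\<xi>. (X \<xi> - \<eta>) / \<kappa>)"
  using X_integrable by simp

lemma \<phi>_argument_integrable: "integrable N (\<lambda>\<xi>. \<phi> ((X \<xi> - \<eta>) / \<kappa>))"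
proof (rule Bochner_Integration.integrable_bound)
  show "integrable N (\<lambda>\<xi>. \<bar>\<phi> 0\<bar> + \<bar>\<phi>' 0\<bar> * \<bar>(X \<xi> - \<eta>) / \<kappa>\<bar> + M / 2 * ((X \<xi> - \<eta>) / \<kappa>)\<^sup>2)"
    using argument_integrable[of \<eta>] argument_square_integrable[of \<eta>]
    by (intro Bochner_Integration.integrable_add integrable_mult_right integrable_abs) simp_all
  have "\<bar>\<phi> y\<bar> \<le> \<bar>\<phi> 0\<bar> + \<bar>\<phi>' 0\<bar> * \<bar>y\<bar> + M / 2 * y\<^sup>2" for y
  proof -
    have "\<bar>\<phi> y - \<phi> 0 - y * \<phi>' 0\<bar> \<le> M / 2 * y\<^sup>2"
      using lipschitz_derivative_abs_bound[OF DERIV_\<phi> lipschitz_\<phi>', of 0 y] by simp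
    moreover have "\<bar>y * \<phi>' 0\<bar> = \<bar>\<phi>' 0\<bar> * \<bar>y\<bar>"
      by (simp add: abs_mult)
    ultimately show ?thesis by linarith
  qed
  then show "AE \<xi> in N. norm (\<phi> ((X \<xi> - \<eta>) / \<kappa>))
      \<le> norm (\<bar>\<phi> 0\<bar> + \<bar>\<phi>' 0\<bar> * \<bar>(X \<xi> - \<eta>) / \<kappa>\<bar> + M / 2 * ((X \<xi> - \<eta>) / \<kappa>)\<^sup>2)"
    by (intro AE_I2) (metis abs_ge_self order_trans real_norm_def)
qed measurable

lemma sample_grad_square_integrable: "integrable N (\<lambda>\<xi>. (sample_grad \<eta> \<xi>)\<^sup>2)"
proof (rule Bochner_Integration.integrable_bound)
  show "integrable N (\<lambda>\<xi>. 2 * (1 - \<phi>' 0)\<^sup>2 + 2 * M\<^sup>2 * ((X \<xi> - \<eta>) / \<kappa>)\<^sup>2)"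
    using argument_square_integrable[of \<eta>]
    by (intro Bochner_Integration.integrable_add integrable_mult_right) simp_all
  have "(1 - \<phi>' y)\<^sup>2 \<le> 2 * (1 - \<phi>' 0)\<^sup>2 + 2 * M\<^sup>2 * y\<^sup>2" for y
  proof -
    have "\<bar>\<phi>' y - \<phi>' 0\<bar> \<le> \<bar>M * y\<bar>"
      using lipschitz_onD[OF lipschitz_\<phi>', of y 0] lipschitz_on_nonneg[OF lipschitz_\<phi>']
      by (simp add: dist_real_def abs_mult)
    then have "(\<phi>' y - \<phi>' 0)\<^sup>2 \<le> M\<^sup>2 * y\<^sup>2"
      by (metis abs_le_square_iff power_mult_distrib)
    moreover have "(1 - \<phi>' y)\<^sup>2 \<le> 2 * (1 - \<phi>' 0)\<^sup>2 + 2 * (\<phi>' y - \<phi>' 0)\<^sup>2"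
      using zero_le_power2[of "(1 - \<phi>' 0) + (\<phi>' y - \<phi>' 0)"]
      by (simp add: power2_eq_square algebra_simps)
    ultimately show ?thesis by linarith
  qed
  then show "AE \<xi> in N. norm ((sample_grad \<eta> \<xi>)\<^sup>2)
      \<le> norm (2 * (1 - \<phi>' 0)\<^sup>2 + 2 * M\<^sup>2 * ((X \<xi> - \<eta>) / \<kappa>)\<^sup>2)"
    by (intro AE_I2) (simp add: sample_grad_def)
qed measurable

lemma sample_grad_integrable: "integrable N (sample_grad \<eta>)"
  by (rule square_integrable_imp_integrable[OF _ sample_grad_square_integrable]) measurable

text \<open>Integrating the pointwise remainder bound for \<open>\<phi>\<close> gives smoothness of the objective with
  constant \<open>M / \<kappa>\<close>: the inner scaling contributes \<open>1 / \<kappa>\<^sup>2\<close> and the outer one \<open>\<kappa>\<close>.\<close>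

lemma risk_remainder: "\<bar>risk (\<eta> + h) - risk \<eta> - h * risk_grad \<eta>\<bar> \<le> M / \<kappa> / 2 * h\<^sup>2"
proof -
  define r where
    "r \<xi> = \<kappa> * \<phi> ((X \<xi> - (\<eta> + h)) / \<kappa>) - \<kappa> * \<phi> ((X \<xi> - \<eta>) / \<kappa>) + h - h * sample_grad \<eta> \<xi>" for \<xi>
  have int: "integrable N r"
    unfolding r_def using \<phi>_argument_integrable sample_grad_integrable by simp
  have "risk (\<eta> + h) - risk \<eta> - h * risk_grad \<eta> = (\<integral>\<xi>. r \<xi> \<partial>N)"
    unfolding r_def risk_def risk_grad_def
    using \<phi>_argument_integrable sample_grad_integrable by (simp add: prob_space)
  moreover have "\<bar>r \<xi>\<bar> \<le> M / \<kappa> / 2 * h\<^sup>2" for \<xi>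
  proof -
    define v where "v = (X \<xi> - \<eta>) / \<kappa>"
    have arg: "(X \<xi> - (\<eta> + h)) / \<kappa> = v + (- h / \<kappa>)"
      by (simp add: v_def diff_divide_distrib add_divide_distrib)
    have "r \<xi> = \<kappa> * (\<phi> (v + (- h / \<kappa>)) - \<phi> v - (- h / \<kappa>) * \<phi>' v)"
      unfolding r_def sample_grad_def arg v_def[symmetric]
      using \<kappa>_pos by (simp add: algebra_simps)
    then have "\<bar>r \<xi>\<bar> = \<kappa> * \<bar>\<phi> (v + (- h / \<kappa>)) - \<phi> v - (- h / \<kappa>) * \<phi>' v\<bar>"
      using \<kappa>_pos by (simp add: abs_mult)
    also have "\<dots> \<le> \<kappa> * (M * (- h / \<kappa>)\<^sup>2 / 2)"
      using \<kappa>_pos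
      by (intro mult_left_mono lipschitz_derivative_abs_bound[OF DERIV_\<phi> lipschitz_\<phi>']) simp
    also have "\<dots> = M / \<kappa> / 2 * h\<^sup>2"
      using \<kappa>_pos by (simp add: power2_eq_square)
    finally show ?thesis .
  qed
  then have "(\<integral>\<xi>. \<bar>r \<xi>\<bar> \<partial>N) \<le> (\<integral>\<xi>. M / \<kappa> / 2 * h\<^sup>2 \<partial>N)"
    using int by (intro integral_mono) auto
  then have "(\<integral>\<xi>. \<bar>r \<xi>\<bar> \<partial>N) \<le> M / \<kappa> / 2 * h\<^sup>2"
    by (simp add: prob_space)
  ultimately show ?thesis
    using integral_abs_bound[of N r] by linarith
qed

lemma DERIV_risk: "(risk has_real_derivative risk_grad \<eta>) (at \<eta>)"
  using risk_remainder by (rule quadratic_remainder_imp_DERIV)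

lemma deriv_risk: "deriv risk = risk_grad"
  using DERIV_risk DERIV_imp_deriv by blast

lemma risk_ge_expectation:
  assumes "\<And>v. v \<le> \<phi> v"
  shows "expectation X \<le> risk \<eta>"
proof -
  have "(\<integral>\<xi>. X \<xi> - \<eta> \<partial>N) \<le> (\<integral>\<xi>. \<kappa> * \<phi> ((X \<xi> - \<eta>) / \<kappa>) \<partial>N)"
  proof (intro integral_mono)
    show "X \<xi> - \<eta> \<le> \<kappa> * \<phi> ((X \<xi> - \<eta>) / \<kappa>)" for \<xi>
      using mult_left_mono[OF assms[of "(X \<xi> - \<eta>) / \<kappa>"], of \<kappa>] \<kappa>_pos by simp
  qed (use X_integrable \<phi>_argument_integrable in auto)
  then show ?thesis
    using X_integrable by (simp add: risk_def prob_space)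
qed

text \<open>A Lipschitz map contracts variances: compare with the second moment about its value at the
  mean of the argument.\<close>

lemma variance_sample_grad: "variance (sample_grad \<eta>) \<le> M\<^sup>2 / \<kappa>\<^sup>2 * variance X"
proof -
  define m where "m = (expectation X - \<eta>) / \<kappa>"
  have "variance (sample_grad \<eta>) \<le> expectation (\<lambda>\<xi>. (sample_grad \<eta> \<xi> - (1 - \<phi>' m))\<^sup>2)"
    by (rule variance_le_second_moment_about[OF sample_grad_integrable sample_grad_square_integrable])
  also have "\<dots> \<le> (\<integral>\<xi>. M\<^sup>2 / \<kappa>\<^sup>2 * (X \<xi> - expectation X)\<^sup>2 \<partial>N)"
  proof (rule integral_mono')
    show "integrable N (\<lambda>\<xi>. M\<^sup>2 / \<kappa>\<^sup>2 * (X \<xi> - expectation X)\<^sup>2)"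
      using X_integrable X_square_integrable by (simp add: power2_diff)
    fix \<xi>
    have "\<bar>\<phi>' ((X \<xi> - \<eta>) / \<kappa>) - \<phi>' m\<bar> \<le> M * \<bar>(X \<xi> - \<eta>) / \<kappa> - m\<bar>"
      using lipschitz_onD[OF lipschitz_\<phi>'] by (simp add: dist_real_def)
    also have "(X \<xi> - \<eta>) / \<kappa> - m = (X \<xi> - expectation X) / \<kappa>"
      by (simp add: m_def diff_divide_distrib)
    also have "M * \<bar>(X \<xi> - expectation X) / \<kappa>\<bar> = \<bar>M / \<kappa> * (X \<xi> - expectation X)\<bar>"
      using lipschitz_on_nonneg[OF lipschitz_\<phi>'] by (simp add: abs_mult)
    finally have "(\<phi>' ((X \<xi> - \<eta>) / \<kappa>) - \<phi>' m)\<^sup>2 \<le> (M / \<kappa> * (X \<xi> - expectation X))\<^sup>2"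
      unfolding abs_le_square_iff .
    then show "(sample_grad \<eta> \<xi> - (1 - \<phi>' m))\<^sup>2 \<le> M\<^sup>2 / \<kappa>\<^sup>2 * (X \<xi> - expectation X)\<^sup>2"
      by (simp add: sample_grad_def power_mult_distrib power_divide power2_commute)
  qed simp
  finally show ?thesis by simp
qed

text \<open>One stochastic gradient step decreases the expected objective up to the gradient noise. It is
  stated with nonnegative integrals, after subtraction of a lower bound \<open>m\<close>, so that no
  integrability has to be carried along the trajectory.\<close>

lemma sgd_step_drift:
  assumes lower: "\<And>\<eta>. m \<le> risk \<eta>"
    and var: "variance X \<le> V"
    and step: "0 \<le> \<alpha>" "\<alpha> \<le> \<kappa> / M" and M_pos: "M > 0"
  shows "(\<integral>\<^sup>+\<xi>. ennreal (risk (\<eta> - \<alpha> * sample_grad \<eta> \<xi>) - m) \<partial>N)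
           + ennreal (\<alpha> * (1 - M / \<kappa> * \<alpha> / 2) * (risk_grad \<eta>)\<^sup>2)
         \<le> ennreal (risk \<eta> - m) + ennreal (M / \<kappa> * \<alpha>\<^sup>2 * (M\<^sup>2 / \<kappa>\<^sup>2 * V) / 2)"
proof -
  define K where "K = M / \<kappa>"
  define u where
    "u \<xi> = risk \<eta> - m - \<alpha> * risk_grad \<eta> * sample_grad \<eta> \<xi> + K * \<alpha>\<^sup>2 / 2 * (sample_grad \<eta> \<xi>)\<^sup>2"
    for \<xi>
  have K_pos: "K > 0"
    using M_pos \<kappa>_pos by (simp add: K_def)
  have K_step: "K * \<alpha> \<le> 1"
    using step M_pos \<kappa>_pos by (simp add: K_def field_simps)
  have u: "risk (\<eta> - \<alpha> * sample_grad \<eta> \<xi>) - m \<le> u \<xi>" for \<xi>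
    using risk_remainder[of \<eta> "- (\<alpha> * sample_grad \<eta> \<xi>)"]
    by (simp add: u_def K_def power_mult_distrib algebra_simps)
  have u_nonneg: "0 \<le> u \<xi>" for \<xi>
    using u[of \<xi>] lower[of "\<eta> - \<alpha> * sample_grad \<eta> \<xi>"] by linarith
  have u_int: "integrable N u"
    unfolding u_def using sample_grad_integrable sample_grad_square_integrable by simp
  have second_moment: "(\<integral>\<xi>. (sample_grad \<eta> \<xi>)\<^sup>2 \<partial>N) \<le> (risk_grad \<eta>)\<^sup>2 + M\<^sup>2 / \<kappa>\<^sup>2 * V"
  proof -
    have "(\<integral>\<xi>. (sample_grad \<eta> \<xi>)\<^sup>2 \<partial>N) = variance (sample_grad \<eta>) + (risk_grad \<eta>)\<^sup>2"
      using variance_eq[OF sample_grad_integrable sample_grad_square_integrable]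
      by (simp add: risk_grad_def)
    moreover have "M\<^sup>2 / \<kappa>\<^sup>2 * variance X \<le> M\<^sup>2 / \<kappa>\<^sup>2 * V"
      using var by (intro mult_left_mono) auto
    ultimately show ?thesis
      using variance_sample_grad[of \<eta>] by linarith
  qed
  have V_nonneg: "0 \<le> V"
    using variance_positive[of X] var by linarith
  have "(\<integral>\<xi>. u \<xi> \<partial>N) = risk \<eta> - m - \<alpha> * (risk_grad \<eta>)\<^sup>2
          + K * \<alpha>\<^sup>2 / 2 * (\<integral>\<xi>. (sample_grad \<eta> \<xi>)\<^sup>2 \<partial>N)"
    unfolding u_def using sample_grad_integrable sample_grad_square_integrable
    by (simp add: prob_space power2_eq_square flip: risk_grad_def)
  also have "\<dots> \<le> risk \<eta> - m - \<alpha> * (risk_grad \<eta>)\<^sup>2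
          + K * \<alpha>\<^sup>2 / 2 * ((risk_grad \<eta>)\<^sup>2 + M\<^sup>2 / \<kappa>\<^sup>2 * V)"
    using K_pos by (intro add_left_mono mult_left_mono second_moment) auto
  finally have mean: "(\<integral>\<xi>. u \<xi> \<partial>N) + \<alpha> * (1 - K * \<alpha> / 2) * (risk_grad \<eta>)\<^sup>2
      \<le> (risk \<eta> - m) + K * \<alpha>\<^sup>2 * (M\<^sup>2 / \<kappa>\<^sup>2 * V) / 2"
    by (simp add: algebra_simps power2_eq_square)
  have "(\<integral>\<^sup>+\<xi>. ennreal (risk (\<eta> - \<alpha> * sample_grad \<eta> \<xi>) - m) \<partial>N) \<le> (\<integral>\<^sup>+\<xi>. ennreal (u \<xi>) \<partial>N)"
    by (intro nn_integral_mono ennreal_leI u)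
  also have "\<dots> = ennreal (\<integral>\<xi>. u \<xi> \<partial>N)"
    using u_int u_nonneg by (intro nn_integral_eq_integral) auto
  finally have "(\<integral>\<^sup>+\<xi>. ennreal (risk (\<eta> - \<alpha> * sample_grad \<eta> \<xi>) - m) \<partial>N)
        + ennreal (\<alpha> * (1 - K * \<alpha> / 2) * (risk_grad \<eta>)\<^sup>2)
      \<le> ennreal (\<integral>\<xi>. u \<xi> \<partial>N) + ennreal (\<alpha> * (1 - K * \<alpha> / 2) * (risk_grad \<eta>)\<^sup>2)"
    by (rule add_right_mono)
  also have "\<dots> = ennreal ((\<integral>\<xi>. u \<xi> \<partial>N) + \<alpha> * (1 - K * \<alpha> / 2) * (risk_grad \<eta>)\<^sup>2)"
    using u_nonneg step K_step
    by (intro ennreal_plus[symmetric] integral_nonneg_AE mult_nonneg_nonneg) auto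
  also have "\<dots> \<le> ennreal ((risk \<eta> - m) + K * \<alpha>\<^sup>2 * (M\<^sup>2 / \<kappa>\<^sup>2 * V) / 2)"
    using mean by (rule ennreal_leI)
  also have "\<dots> = ennreal (risk \<eta> - m) + ennreal (K * \<alpha>\<^sup>2 * (M\<^sup>2 / \<kappa>\<^sup>2 * V) / 2)"
    using lower[of \<eta>] K_pos V_nonneg by (intro ennreal_plus) auto
  finally show ?thesis by (simp add: K_def)
qed

end

section \<open>Trajectories driven by independent samples\<close>

text \<open>Independence in the form needed below: redrawing one coordinate of a product measure does not
  change its law. In this way the whole argument stays on one product space and needs neither
  conditional expectations nor a change of index set between steps.\<close>

lemma nn_integral_PiM_resample:
  assumes N: "prob_space N" and I: "finite I" "i \<in> I"
    and [measurable]: "g \<in> borel_measurable (Pi\<^sub>M I (\<lambda>_. N))"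
  shows "(\<integral>\<^sup>+w. g w \<partial>Pi\<^sub>M I (\<lambda>_. N))
       = (\<integral>\<^sup>+w. (\<integral>\<^sup>+\<xi>. g (w(i := \<xi>)) \<partial>N) \<partial>Pi\<^sub>M I (\<lambda>_. N))"
proof -
  interpret N: prob_space N by (rule N)
  interpret product_sigma_finite "\<lambda>_. N" by standard
  let ?J = "I - {i}"
  have J: "finite ?J" "i \<notin> ?J" and insert_J: "insert i ?J = I"
    using I by auto
  have upd [measurable]: "(\<lambda>(w, \<xi>). g (w(i := \<xi>))) \<in> borel_measurable (Pi\<^sub>M I (\<lambda>_. N) \<Otimes>\<^sub>M N)"
    using measurable_compose[OF measurable_add_dim[of i I "\<lambda>_. N"], of g borel] I
    by (simp add: insert_absorb case_prod_unfold)
  have "(\<integral>\<^sup>+w. (\<integral>\<^sup>+\<xi>. g (w(i := \<xi>)) \<partial>N) \<partial>Pi\<^sub>M I (\<lambda>_. N))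
      = (\<integral>\<^sup>+w. (\<integral>\<^sup>+\<xi>'. (\<integral>\<^sup>+\<xi>. g (w(i := \<xi>', i := \<xi>)) \<partial>N) \<partial>N) \<partial>Pi\<^sub>M ?J (\<lambda>_. N))"
    using product_nn_integral_insert[OF J, of "\<lambda>w. \<integral>\<^sup>+\<xi>. g (w(i := \<xi>)) \<partial>N"]
    unfolding insert_J by simp
  also have "\<dots> = (\<integral>\<^sup>+w. (\<integral>\<^sup>+\<xi>. g (w(i := \<xi>)) \<partial>N) \<partial>Pi\<^sub>M ?J (\<lambda>_. N))"
    by (simp add: N.emeasure_space_1)
  also have "\<dots> = (\<integral>\<^sup>+w. g w \<partial>Pi\<^sub>M I (\<lambda>_. N))"
    using product_nn_integral_insert[OF J, of g] unfolding insert_J by simp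
  finally show ?thesis by simp
qed

text \<open>Step \<open>d\<close> reads coordinate \<open>key d\<close>. Injectivity of \<open>key\<close> is what makes the sample of a step
  independent of the state it acts on. The condition on \<open>key d\<close> ends at \<open>D\<close>, since a finite
  product carries samples for finitely many steps only.\<close>

locale driven_trajectory = N: prob_space N for N :: "'a measure" +
  fixes I :: "'i set" and key :: "nat \<Rightarrow> 'i" and D :: nat
    and move :: "real \<Rightarrow> 'a \<Rightarrow> real" and start :: real and state :: "('i \<Rightarrow> 'a) \<Rightarrow> nat \<Rightarrow> real"
  assumes finite_I: "finite I"
    and key_in: "\<And>d. d < D \<Longrightarrow> key d \<in> I"
    and inj_key: "inj key"
    and move_measurable [measurable]: "case_prod move \<in> borel_measurable (borel \<Otimes>\<^sub>M N)"
    and state_0: "\<And>\<omega>. state \<omega> 0 = start"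
    and state_Suc: "\<And>\<omega> d. state \<omega> (Suc d) = move (state \<omega> d) (\<omega> (key d))"
begin

abbreviation "samples \<equiv> Pi\<^sub>M I (\<lambda>_. N)"

lemma state_measurable: "d \<le> D \<Longrightarrow> (\<lambda>\<omega>. state \<omega> d) \<in> borel_measurable samples"
proof (induction d)
  case (Suc d)
  have [measurable]: "(\<lambda>\<omega>. state \<omega> d) \<in> borel_measurable samples"
    using Suc by simp
  have [measurable]: "(\<lambda>\<omega>. \<omega> (key d)) \<in> measurable samples N"
    using Suc.prems key_in by (intro measurable_component_singleton) simp
  show ?case unfolding state_Suc by measurable
qed (simp add: state_0)

lemma state_update: "d \<le> e \<Longrightarrow> state (w(key e := \<xi>)) d = state w d"
proof (induction d)
  case (Suc d)
  then show ?case using inj_eq[OF inj_key, of d e] by (simp add: state_Suc)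
qed (simp add: state_0)

text \<open>The state after \<open>d\<close> steps does not look at coordinate \<open>key d\<close>, so resampling that coordinate
  turns the next state into a move with an independent sample.\<close>

lemma nn_integral_state_Suc:
  assumes d: "d < D" and [measurable]: "h \<in> borel_measurable borel"
  shows "(\<integral>\<^sup>+\<omega>. h (state \<omega> (Suc d)) \<partial>samples)
       = (\<integral>\<^sup>+\<omega>. (\<integral>\<^sup>+\<xi>. h (move (state \<omega> d) \<xi>) \<partial>N) \<partial>samples)"
proof -
  have [measurable]: "(\<lambda>\<omega>. state \<omega> (Suc d)) \<in> borel_measurable samples"
    using d by (intro state_measurable) simp
  show ?thesis
    by (subst nn_integral_PiM_resample[OF N.prob_space_axioms finite_I key_in[OF d]], measurable)
       (simp add: state_Suc state_update)
qed

text \<open>The discrete form of a Lyapunov argument: the drift inequality telescopes. Keeping the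
  potential of the last state on the left makes the induction go through without subtraction in the
  extended nonnegative reals.\<close>

lemma drift_sum:
  fixes V S :: "real \<Rightarrow> ennreal" and b :: ennreal
  assumes [measurable]: "V \<in> borel_measurable borel" "S \<in> borel_measurable borel"
    and drift: "\<And>s. (\<integral>\<^sup>+\<xi>. V (move s \<xi>) \<partial>N) + S s \<le> V s + b"
  shows "(\<integral>\<^sup>+\<omega>. (\<Sum>d<D. S (state \<omega> d)) \<partial>samples) \<le> V start + of_nat D * b"
proof -
  have prob: "emeasure samples (space samples) = 1"
    by (intro prob_space.emeasure_space_1 prob_space_PiM N.prob_space_axioms)
  have "n \<le> D \<Longrightarrow> (\<integral>\<^sup>+\<omega>. V (state \<omega> n) \<partial>samples) + (\<integral>\<^sup>+\<omega>. (\<Sum>d<n. S (state \<omega> d)) \<partial>samples)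
      \<le> V start + of_nat n * b" for n
  proof (induction n)
    case 0
    then show ?case by (simp add: state_0 prob)
  next
    case (Suc n)
    have state_meas [measurable]: "(\<lambda>\<omega>. state \<omega> d) \<in> borel_measurable samples" if "d \<le> n" for d
      using that Suc.prems by (intro state_measurable) simp
    have sum_meas: "(\<lambda>\<omega>. \<Sum>d<n. S (state \<omega> d)) \<in> borel_measurable samples"
      by (intro borel_measurable_sum measurable_compose[OF state_meas]) auto
    have [measurable]: "(\<lambda>\<omega>. state \<omega> n) \<in> borel_measurable samples"
      by (rule state_meas) simp
    have "(\<integral>\<^sup>+\<omega>. V (state \<omega> (Suc n)) \<partial>samples) + (\<integral>\<^sup>+\<omega>. (\<Sum>d<Suc n. S (state \<omega> d)) \<partial>samples)
        = (\<integral>\<^sup>+\<omega>. (\<integral>\<^sup>+\<xi>. V (move (state \<omega> n) \<xi>) \<partial>N) \<partial>samples)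
          + ((\<integral>\<^sup>+\<omega>. (\<Sum>d<n. S (state \<omega> d)) \<partial>samples) + (\<integral>\<^sup>+\<omega>. S (state \<omega> n) \<partial>samples))"
      using Suc.prems sum_meas by (simp add: nn_integral_state_Suc nn_integral_add)
    also have "\<dots> = (\<integral>\<^sup>+\<omega>. (\<integral>\<^sup>+\<xi>. V (move (state \<omega> n) \<xi>) \<partial>N) + S (state \<omega> n) \<partial>samples)
          + (\<integral>\<^sup>+\<omega>. (\<Sum>d<n. S (state \<omega> d)) \<partial>samples)"
      by (simp add: nn_integral_add add_ac)
    also have "\<dots> \<le> (\<integral>\<^sup>+\<omega>. V (state \<omega> n) + b \<partial>samples)
          + (\<integral>\<^sup>+\<omega>. (\<Sum>d<n. S (state \<omega> d)) \<partial>samples)"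
      by (intro add_right_mono nn_integral_mono drift)
    also have "\<dots> = ((\<integral>\<^sup>+\<omega>. V (state \<omega> n) \<partial>samples)
          + (\<integral>\<^sup>+\<omega>. (\<Sum>d<n. S (state \<omega> d)) \<partial>samples)) + b"
      by (simp add: nn_integral_add prob add_ac)
    also have "\<dots> \<le> (V start + of_nat n * b) + b"
      using Suc by (intro add_right_mono) simp
    also have "\<dots> = V start + of_nat (Suc n) * b"
      by (simp add: algebra_simps)
    finally show ?case .
  qed
  from this[of D, OF order_refl] show ?thesis
    by (rule order_trans[OF add_increasing[OF zero_le order_refl]])
qed

text \<open>Stopping at an independent uniform time averages over the trajectory.\<close>

lemma nn_integral_uniform_time:
  fixes h :: "real \<Rightarrow> ennreal"
  assumes D: "D > 0" and [measurable]: "h \<in> borel_measurable borel"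
  shows "(\<integral>\<^sup>+s. h s \<partial>distr (samples \<Otimes>\<^sub>M uniform_count_measure {..<D}) borel (\<lambda>(\<omega>, d). state \<omega> d))
       = (\<integral>\<^sup>+\<omega>. (\<Sum>d<D. h (state \<omega> d)) \<partial>samples) * ennreal (1 / real D)"
proof -
  interpret U: prob_space "uniform_count_measure {..<D}"
    using D by (intro prob_space_uniform_count_measure) auto
  have state_meas: "(\<lambda>\<omega>. state \<omega> d) \<in> borel_measurable samples" if "d < D" for d
    using that by (intro state_measurable) simp
  have "(\<lambda>(d, \<omega>). state \<omega> d) \<in> borel_measurable (count_space {..<D} \<Otimes>\<^sub>M samples)"
    using state_meas by (intro measurable_pair_measure_countable1) auto
  then have "(\<lambda>(\<omega>, d). state \<omega> d) \<in> borel_measurable (samples \<Otimes>\<^sub>M count_space {..<D})"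
    by (rule measurable_pair_swap[where f = "\<lambda>(d, \<omega>). state \<omega> d", simplified])
  then have [measurable]:
    "(\<lambda>(\<omega>, d). state \<omega> d) \<in> borel_measurable (samples \<Otimes>\<^sub>M uniform_count_measure {..<D})"
    by (simp cong: measurable_cong_sets
          add: sets_pair_measure_cong[OF refl sets_uniform_count_measure_count_space])
  have "(\<integral>\<^sup>+s. h s \<partial>distr (samples \<Otimes>\<^sub>M uniform_count_measure {..<D}) borel (\<lambda>(\<omega>, d). state \<omega> d))
      = (\<integral>\<^sup>+\<omega>. (\<integral>\<^sup>+d. h (state \<omega> d) \<partial>uniform_count_measure {..<D}) \<partial>samples)"
    by (subst nn_integral_distr, measurable, subst U.nn_integral_fst[symmetric])
       (auto simp: case_prod_unfold)
  also have "\<dots> = (\<integral>\<^sup>+\<omega>. (\<Sum>d<D. h (state \<omega> d)) * ennreal (1 / real D) \<partial>samples)"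
    by (simp add: uniform_count_measure_def nn_integral_point_measure_finite sum_distrib_left
        mult.commute)
  also have "\<dots> = (\<integral>\<^sup>+\<omega>. (\<Sum>d<D. h (state \<omega> d)) \<partial>samples) * ennreal (1 / real D)"
    by (intro nn_integral_multc borel_measurable_sum measurable_compose[OF state_meas]) auto
  finally show ?thesis .
qed

end

section \<open>The inner algorithm\<close>

text \<open>Testing the supremum at \<open>r = 1\<close>. This makes the dual objective bounded below, so that \<open>Psi\<close>
  is a genuine infimum.\<close>

lemma fstar_ge:
  assumes "f 1 = 0" "\<bar>conjugate f v\<bar> \<noteq> \<infinity>"
  shows "v \<le> fstar f v"
proof -
  have "ereal (v * 1) - f 1 \<le> conjugate f v"
    unfolding conjugate_def by (rule SUP_upper) simp
  then show ?thesis
    using assms by (cases "conjugate f v") (auto simp: fstar_def)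
qed

text \<open>Telescoping bounds the averaged squared derivative by
  \<open>(gap / D + K * \<alpha>\<^sup>2 * R / 2) / (\<alpha> * (1 - K * \<alpha> / 2))\<close>; the last premise says that this is
  at most \<open>e\<close>.\<close>

lemma (in dro_setting) expected_sq_grad_le:
  fixes xt :: "real ^ 'd" and \<zeta> :: 'a and init :: real
  defines "K \<equiv> M / (lam * \<beta>)"
    and "R \<equiv> 2 * M\<^sup>2 / (lam * \<beta>)\<^sup>2 * (\<sigma>\<^sup>2 + lam\<^sup>2 * \<delta>\<^sup>2)"
    and "gap \<equiv> dual_obj \<nu> lam \<beta> l c f \<zeta> xt init - Psi \<nu> lam \<beta> l c f \<zeta> xt"
  assumes \<zeta>: "\<zeta> \<in> space \<nu>"
  shows "\<lbrakk>0 < \<alpha>; \<alpha> \<le> 1 / K; D > 0;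
          gap / real D + K * \<alpha>\<^sup>2 * R / 2 \<le> \<alpha> * (1 - K * \<alpha> / 2) * e\<rbrakk>
         \<Longrightarrow> expected_sq_grad \<nu> lam \<beta> l c f xt \<zeta> init (\<lambda>d. \<alpha>) 1 D \<le> ennreal e"
proof -
  define \<kappa> where "\<kappa> = lam * \<beta>"
  define X where "X \<xi> = l xt \<xi> - lam * c \<zeta> \<xi>" for \<xi>
  define V where "V = 2 * (\<sigma>\<^sup>2 + lam\<^sup>2 * \<delta>\<^sup>2)"
  define m where "m = Psi \<nu> lam \<beta> l c f \<zeta> xt"
  note loss = loss_variance[of xt, unfolded variance_le_def]
  note cost = cost_variance_xi[OF \<zeta>, unfolded variance_le_def]
  interpret shifted_risk \<nu> "fstar f" "deriv (fstar f)" M \<kappa> X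
  proof
    show "\<kappa> > 0" using pos by (simp add: \<kappa>_def)
    show "(fstar f has_real_derivative deriv (fstar f) v) (at v)" for v
      using fstar_differentiable DERIV_deriv_iff_real_differentiable by blast
    show "M-lipschitz_on UNIV (deriv (fstar f))" by (rule fstar_smooth)
    show "X \<in> borel_measurable \<nu>"
      unfolding X_def[abs_def] using loss cost by auto
    show "integrable \<nu> (\<lambda>\<xi>. (X \<xi>)\<^sup>2)"
      unfolding X_def using loss cost by (intro nu.variance_diff_scaled_le) auto
  qed
  have risk_eq: "dual_obj \<nu> lam \<beta> l c f \<zeta> xt = risk"
    unfolding dual_obj_def[abs_def] risk_def[abs_def] unfolding X_def \<kappa>_def ..
  have lower: "m \<le> risk \<eta>" for \<eta>
  proof -
    have "bdd_below (range risk)"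
      using risk_ge_expectation[OF fstar_ge[OF f_one conjugate_finite]] by (intro bdd_belowI) auto
    then show ?thesis
      unfolding m_def Psi_def risk_eq by (intro cINF_lower) auto
  qed
  have gap_nonneg: "gap \<ge> 0"
    using lower[of init] by (simp add: gap_def risk_eq m_def)
  have var_X: "nu.variance X \<le> V"
  proof -
    have "nu.variance X \<le> 2 * (nu.variance (l xt) + lam\<^sup>2 * nu.variance (c \<zeta>))"
      unfolding X_def using loss cost by (intro nu.variance_diff_scaled_le) auto
    also have "\<dots> \<le> V"
      unfolding V_def using loss cost by (intro mult_left_mono add_mono) auto
    finally show ?thesis .
  qed
  have K: "K = M / \<kappa>" "K > 0" and R: "M\<^sup>2 / \<kappa>\<^sup>2 * V = R" "R \<ge> 0"
    using pos by (simp_all add: K_def R_def V_def \<kappa>_def)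
  show "expected_sq_grad \<nu> lam \<beta> l c f xt \<zeta> init (\<lambda>d. \<alpha>) 1 D \<le> ennreal e"
    if \<alpha>: "0 < \<alpha>" "\<alpha> \<le> 1 / K" and D: "D > 0"
      and e: "gap / real D + K * \<alpha>\<^sup>2 * R / 2 \<le> \<alpha> * (1 - K * \<alpha> / 2) * e"
  proof -
    define a where "a = \<alpha> * (1 - K * \<alpha> / 2)"
    define state where "state = inner_iterate lam \<beta> l c f xt \<zeta> init (\<lambda>d. \<alpha>) 1"
    have a_pos: "a > 0"
    proof -
      have "K * \<alpha> \<le> K * (1 / K)" using \<alpha> K(2) by (intro mult_left_mono) auto
      then have "K * \<alpha> \<le> 1" using K(2) by simp
      then show ?thesis using \<alpha> by (simp add: a_def)
    qed
    interpret driven_trajectory \<nu> "draws D 1" "\<lambda>d. (d, 0)" D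
      "\<lambda>\<eta> \<xi>. \<eta> - \<alpha> * sample_grad \<eta> \<xi>" init state
    proof
      show "case_prod (\<lambda>\<eta> \<xi>. \<eta> - \<alpha> * sample_grad \<eta> \<xi>) \<in> borel_measurable (borel \<Otimes>\<^sub>M \<nu>)"
        by measurable
      show "state \<omega> (Suc d) = state \<omega> d - \<alpha> * sample_grad (state \<omega> d) (\<omega> (d, 0))" for \<omega> d
        by (simp add: state_def batch_grad_def sample_grad_def) (simp add: X_def \<kappa>_def)
    qed (auto simp: draws_def state_def inj_def)
    have "ennreal a * (\<integral>\<^sup>+\<omega>. (\<Sum>d<D. ennreal ((risk_grad (state \<omega> d))\<^sup>2)) \<partial>samples)
        = (\<integral>\<^sup>+\<omega>. (\<Sum>d<D. ennreal (a * (risk_grad (state \<omega> d))\<^sup>2)) \<partial>samples)"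
    proof (subst nn_integral_cmult[symmetric])
      have "(\<lambda>\<omega>. ennreal ((risk_grad (state \<omega> d))\<^sup>2)) \<in> borel_measurable samples" if "d < D" for d
      proof -
        have [measurable]: "(\<lambda>\<omega>. state \<omega> d) \<in> borel_measurable samples"
          using that by (intro state_measurable) simp
        show ?thesis by measurable
      qed
      then show "(\<lambda>\<omega>. \<Sum>d<D. ennreal ((risk_grad (state \<omega> d))\<^sup>2)) \<in> borel_measurable samples"
        by (intro borel_measurable_sum) simp
    qed (use a_pos in \<open>simp add: sum_distrib_left ennreal_mult del: sum_ennreal\<close>)
    also have "\<dots> \<le> ennreal (risk init - m) + of_nat D * ennreal (K * \<alpha>\<^sup>2 * R / 2)"
    proof (rule drift_sum[where V = "\<lambda>s. ennreal (risk s - m)"])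
      show "(\<integral>\<^sup>+\<xi>. ennreal (risk (s - \<alpha> * sample_grad s \<xi>) - m) \<partial>\<nu>) + ennreal (a * (risk_grad s)\<^sup>2)
          \<le> ennreal (risk s - m) + ennreal (K * \<alpha>\<^sup>2 * R / 2)" for s
        using sgd_step_drift[OF lower var_X _ _ pos(4), of \<alpha> s] \<alpha>
        unfolding a_def K(1) R(1)[symmetric] by simp
    qed measurable
    also have "\<dots> = ennreal (gap + real D * (K * \<alpha>\<^sup>2 * R / 2))"
    proof -
      have "0 \<le> K * \<alpha>\<^sup>2 * R / 2" using K(2) R(2) by simp
      then have "of_nat D * ennreal (K * \<alpha>\<^sup>2 * R / 2) = ennreal (real D * (K * \<alpha>\<^sup>2 * R / 2))"
        by (simp only: ennreal_mult of_nat_0_le_iff ennreal_of_nat_eq_real_of_nat)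
      moreover have "risk init - m = gap"
        by (simp add: gap_def risk_eq m_def)
      ultimately show ?thesis
        using gap_nonneg \<open>0 \<le> K * \<alpha>\<^sup>2 * R / 2\<close>
        by (simp only: ennreal_plus[symmetric] mult_nonneg_nonneg of_nat_0_le_iff)
    qed
    also have "\<dots> \<le> ennreal (real D * (a * e))"
    proof (rule ennreal_leI)
      have "real D * (gap / real D + K * \<alpha>\<^sup>2 * R / 2) \<le> real D * (a * e)"
        using e by (intro mult_left_mono) (auto simp: a_def)
      then show "gap + real D * (K * \<alpha>\<^sup>2 * R / 2) \<le> real D * (a * e)"
        using D by (simp add: distrib_left)
    qed
    finally have total: "ennreal a * (\<integral>\<^sup>+\<omega>. (\<Sum>d<D. ennreal ((risk_grad (state \<omega> d))\<^sup>2)) \<partial>samples)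
      \<le> ennreal (real D * (a * e))" .
    have "expected_sq_grad \<nu> lam \<beta> l c f xt \<zeta> init (\<lambda>d. \<alpha>) 1 D
        = (\<integral>\<^sup>+\<omega>. (\<Sum>d<D. ennreal ((risk_grad (state \<omega> d))\<^sup>2)) \<partial>samples) * ennreal (1 / real D)"
      unfolding expected_sq_grad_def inner_sgd_def risk_eq deriv_risk power2_abs state_def[symmetric]
      by (rule nn_integral_uniform_time[OF D]) measurable
    also have "\<dots> = ennreal (1 / (real D * a))
        * (ennreal a * (\<integral>\<^sup>+\<omega>. (\<Sum>d<D. ennreal ((risk_grad (state \<omega> d))\<^sup>2)) \<partial>samples))"
      using a_pos D by (simp add: mult.assoc[symmetric] ennreal_mult[symmetric] mult.commute)
    also have "\<dots> \<le> ennreal (1 / (real D * a)) * ennreal (real D * (a * e))"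
      by (intro mult_left_mono total) simp
    also have "\<dots> = ennreal e"
      using a_pos D by (simp add: ennreal_mult'[symmetric])
    finally show ?thesis .
  qed
qed

section \<open>Step size and number of iterations\<close>

text \<open>With \<open>\<rho> = e / R\<close> for the squared target accuracy \<open>e\<close>, the descent bound asks for
  \<open>gap / D \<le> \<rho> * (1 - \<rho>) * e / (2 * K)\<close> when \<open>\<rho> < 1\<close>, and for \<open>gap / D \<le> (e - R) / (2 * K)\<close>
  when \<open>\<rho> > 1\<close>. At \<open>\<rho> = 1\<close> the noise uses up the whole accuracy, and no \<open>D\<close> is
  large enough for this bound unless the gap vanishes.\<close>

lemma step_size_bound_large_D:
  fixes K R e gap :: real
  assumes pos: "K > 0" "R > 0" "e > 0" and ne: "e \<noteq> R"
  defines "\<alpha> \<equiv> min (1 / K) (e / (R * K))"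
  shows "\<forall>\<^sub>F D in sequentially. gap / real D + K * \<alpha>\<^sup>2 * R / 2 \<le> \<alpha> * (1 - K * \<alpha> / 2) * e"
proof -
  define slack where "slack = \<alpha> * (1 - K * \<alpha> / 2) * e - K * \<alpha>\<^sup>2 * R / 2"
  have "slack > 0"
  proof (cases "e < R")
    case True
    then have "\<alpha> = e / (R * K)"
      using pos by (simp add: \<alpha>_def min_def field_simps)
    have "slack = e\<^sup>2 / (R * K) * ((1 - e / R) / 2)"
      unfolding slack_def \<open>\<alpha> = _\<close> using pos by (simp add: power2_eq_square field_simps)
    then show ?thesis using True pos by simp
  next
    case False
    then have "\<alpha> = 1 / K"
      using pos by (simp add: \<alpha>_def min_def field_simps)
    have "slack = (e - R) / (2 * K)"
      unfolding slack_def \<open>\<alpha> = _\<close> using pos by (simp add: power2_eq_square field_simps)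
    then show ?thesis using False ne pos by simp
  qed
  moreover have "(\<lambda>D. gap / real D) \<longlonglongrightarrow> 0"
    by (rule lim_const_over_n)
  ultimately have "\<forall>\<^sub>F D in sequentially. gap / real D < slack"
    by (rule order_tendstoD(2)[rotated])
  then show ?thesis
    by eventually_elim (simp add: slack_def)
qed

lemma step_size_bound_small_target:
  fixes K R e gap :: real
  assumes pos: "K > 0" "R > 0" "e > 0" and small: "e \<le> R / 2"
    and D: "real D \<ge> 4 * (gap * (K * R / e\<^sup>2))" "D > 0"
  defines "\<alpha> \<equiv> min (1 / K) (e / (R * K))"
  shows "gap / real D + K * \<alpha>\<^sup>2 * R / 2 \<le> \<alpha> * (1 - K * \<alpha> / 2) * e"
proof -
  have "\<alpha> = e / (R * K)"
    using pos small by (simp add: \<alpha>_def min_def field_simps)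
  have slack: "\<alpha> * (1 - K * \<alpha> / 2) * e - K * \<alpha>\<^sup>2 * R / 2 = e\<^sup>2 / (R * K) * ((1 - e / R) / 2)"
    unfolding \<open>\<alpha> = _\<close> using pos by (simp add: power2_eq_square field_simps)
  have "gap / real D \<le> e\<^sup>2 / (R * K) * (1 / 4)"
    using D pos by (simp add: field_simps)
  also have "\<dots> \<le> e\<^sup>2 / (R * K) * ((1 - e / R) / 2)"
    using small pos by (intro mult_left_mono) (auto simp: field_simps)
  finally show ?thesis using slack by linarith
qed

text \<open>Rounding up costs at most a factor two once the number exceeds one.\<close>

lemma nat_ceiling_le_double:
  fixes t :: real
  shows "real (max 1 (nat \<lceil>t\<rceil>)) \<le> max 1 (2 * t)"
proof (cases "t \<le> 1")
  case True
  then have "\<lceil>t\<rceil> \<le> 1" by (simp add: ceiling_le_iff)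
  then show ?thesis by simp
next
  case False
  then show ?thesis using ceiling_correct[of t] by simp
qed

lemma oracle_complexity_single: "oracle_complexity D 1 = D"
  by (simp add: oracle_complexity_def draws_def)

theorem corollary11:
  "\<exists>C > 0. \<forall>(P :: 'a measure) (\<nu> :: 'a measure) (lam :: real) (\<beta> :: real)
      (l :: real ^ 'd \<Rightarrow> 'a \<Rightarrow> real) (c :: 'a \<Rightarrow> 'a \<Rightarrow> real) (f :: real \<Rightarrow> ereal)
      (G :: real) (L :: real) (M :: real) (\<sigma> :: real) (\<delta> :: real)
      (xt :: real ^ 'd) (\<zeta> :: 'a) (\<eta>0 :: real).
    dro_setting P \<nu> lam \<beta> l c f G L M \<sigma> \<delta> \<longrightarrow> \<zeta> \<in> space \<nu> \<longrightarrow>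
    (let K' = M / (lam * \<beta>);
         R2 = 2 * M\<^sup>2 / (lam * \<beta>)\<^sup>2 * (\<sigma>\<^sup>2 + lam\<^sup>2 * \<delta>\<^sup>2);
         \<Delta> = Delta_hat \<nu> lam \<beta> l c f xt \<eta>0;
         err = (\<lambda>\<epsilon>'. expected_sq_grad \<nu> lam \<beta> l c f xt \<zeta> \<eta>0
                        (\<lambda>d. min (1 / K') (\<epsilon>'\<^sup>2 / (R2 * K'))) 1)
     in
      (\<forall>\<epsilon> > 0. (\<epsilon> / G)\<^sup>2 \<noteq> R2 \<longrightarrow>
         (\<forall>\<^sub>F D in sequentially. err (\<epsilon> / G) D \<le> ennreal ((\<epsilon> / G)\<^sup>2))) \<and>
      (\<forall>\<^sub>F \<epsilon> in at_right (0 :: real). \<exists>D \<ge> 1.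
         (\<forall>D' \<ge> D. err (\<epsilon> / G) D' \<le> ennreal ((\<epsilon> / G)\<^sup>2)) \<and>
         ereal (real D) \<le> max 1 (ereal C * (\<Delta> * ereal (K' * R2 / (\<epsilon> / G) ^ 4))) \<and>
         ereal (real D) \<le> max 1 (ereal C * (\<Delta> * ereal (K' * R2 * G ^ 4 / \<epsilon> ^ 4))) \<and>
         ereal (real (oracle_complexity D 1)) \<le>
           max 1 (ereal C * (\<Delta> * ereal (K' * R2 * G ^ 4 / \<epsilon> ^ 4)))))"
proof (rule exI[of _ 8], intro conjI allI impI, goal_cases)
  case 1
  show ?case by simp
next
  case (2 P \<nu> lam \<beta> l c f G L M \<sigma> \<delta> xt \<zeta> \<eta>0)
  note setting = 2(1) and \<zeta> = 2(2)
  interpret dro_setting P \<nu> lam \<beta> l c f G L M \<sigma> \<delta> by (rule setting)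
  define K where "K = M / (lam * \<beta>)"
  define R where "R = 2 * M\<^sup>2 / (lam * \<beta>)\<^sup>2 * (\<sigma>\<^sup>2 + lam\<^sup>2 * \<delta>\<^sup>2)"
  define \<Delta> where "\<Delta> = Delta_hat \<nu> lam \<beta> l c f xt \<eta>0"
  define gap where "gap = dual_obj \<nu> lam \<beta> l c f \<zeta> xt \<eta>0 - Psi \<nu> lam \<beta> l c f \<zeta> xt"
  define \<alpha> where "\<alpha> e = min (1 / K) (e\<^sup>2 / (R * K))" for e :: real
  define err where "err e = expected_sq_grad \<nu> lam \<beta> l c f xt \<zeta> \<eta>0 (\<lambda>d. \<alpha> e) 1" for e :: real
  have KR: "K > 0" "R > 0"
    using pos by (auto simp: K_def R_def intro!: mult_pos_pos divide_pos_pos add_pos_pos)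
  have gap_le: "ereal gap \<le> \<Delta>"
    unfolding gap_def \<Delta>_def Delta_hat_def using \<zeta> by (rule SUP_upper)
  have err_le: "err e D \<le> ennreal (e\<^sup>2)"
    if "e > 0" "D > 0"
      "gap / real D + K * (\<alpha> e)\<^sup>2 * R / 2 \<le> \<alpha> e * (1 - K * \<alpha> e / 2) * e\<^sup>2" for e D
  proof -
    have "0 < \<alpha> e" "\<alpha> e \<le> 1 / K"
      using that KR by (auto simp: \<alpha>_def)
    then show ?thesis
      using that expected_sq_grad_le[OF \<zeta>, where \<alpha> = "\<alpha> e" and D = D and init = \<eta>0 and xt = xt
          and e = "e\<^sup>2"]
      unfolding err_def K_def R_def gap_def by blast
  qed
  have asymptotic: "\<forall>\<^sub>F D in sequentially. err (\<epsilon> / G) D \<le> ennreal ((\<epsilon> / G)\<^sup>2)"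
    if \<epsilon>: "\<epsilon> > 0" "(\<epsilon> / G)\<^sup>2 \<noteq> R" for \<epsilon>
  proof -
    have e: "\<epsilon> / G > 0" using \<epsilon> pos by simp
    have "\<forall>\<^sub>F D in sequentially. gap / real D + K * (\<alpha> (\<epsilon> / G))\<^sup>2 * R / 2
        \<le> \<alpha> (\<epsilon> / G) * (1 - K * \<alpha> (\<epsilon> / G) / 2) * (\<epsilon> / G)\<^sup>2"
      unfolding \<alpha>_def using KR e \<epsilon> by (intro step_size_bound_large_D) auto
    with eventually_gt_at_top[of 0] show ?thesis
      by eventually_elim (rule err_le[OF e])
  qed
  have complexity: "\<exists>D\<ge>1. (\<forall>D'\<ge>D. err (\<epsilon> / G) D' \<le> ennreal ((\<epsilon> / G)\<^sup>2)) \<and>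
      ereal (real D) \<le> max 1 (ereal 8 * (\<Delta> * ereal (K * R / (\<epsilon> / G) ^ 4)))"
    if \<epsilon>: "\<epsilon> > 0" "\<epsilon> < G * sqrt (R / 2)" for \<epsilon>
  proof -
    define e where "e = \<epsilon> / G"
    define t where "t = gap * (K * R / e ^ 4)"
    have e: "e > 0" using \<epsilon> pos by (simp add: e_def)
    have "e \<le> sqrt (R / 2)"
      using \<epsilon> pos by (simp add: e_def field_simps)
    then have small: "e\<^sup>2 \<le> R / 2"
      using e KR by (metis less_eq_real_def power_mono real_sqrt_pow2 half_gt_zero)
    define D where "D = max 1 (nat \<lceil>4 * t\<rceil>)"
    have "err e D' \<le> ennreal (e\<^sup>2)" if "D' \<ge> D" for D'
    proof (rule err_le)
      have "4 * t \<le> real D"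
        unfolding D_def by (rule order_trans[OF real_nat_ceiling_ge]) simp
      with that have "real D' \<ge> 4 * (gap * (K * R / (e\<^sup>2)\<^sup>2))"
        by (simp add: t_def flip: power_mult)
      moreover show "D' > 0" using that by (simp add: D_def)
      ultimately show "gap / real D' + K * (\<alpha> e)\<^sup>2 * R / 2 \<le> \<alpha> e * (1 - K * \<alpha> e / 2) * e\<^sup>2"
        unfolding \<alpha>_def using KR e small by (intro step_size_bound_small_target) auto
    qed (rule e)
    moreover have "ereal (real D) \<le> max 1 (ereal 8 * (\<Delta> * ereal (K * R / e ^ 4)))"
    proof -
      have "real D \<le> max 1 (8 * t)"
        using nat_ceiling_le_double[of "4 * t"] by (simp add: D_def)
      then have "ereal (real D) \<le> max 1 (ereal (8 * t))"
        by (metis ereal_less_eq(3) ereal_max one_ereal_def)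
      moreover have "ereal t \<le> \<Delta> * ereal (K * R / e ^ 4)"
        using ereal_mult_right_mono[OF gap_le, of "ereal (K * R / e ^ 4)"] KR e
        by (simp add: t_def)
      then have "ereal (8 * t) \<le> ereal 8 * (\<Delta> * ereal (K * R / e ^ 4))"
        using ereal_mult_left_mono[of "ereal t" _ "ereal 8"] by simp
      ultimately show ?thesis
        by (meson max.mono order_refl order_trans)
    qed
    ultimately show ?thesis
      unfolding e_def by (intro exI[of _ D]) (auto simp: D_def)
  qed
  have rescale: "K * R / (\<epsilon> / G) ^ 4 = K * R * G ^ 4 / \<epsilon> ^ 4" for \<epsilon>
    by (simp add: power_divide)
  have "\<forall>\<^sub>F \<epsilon> in at_right 0. \<epsilon> > 0 \<and> \<epsilon> < G * sqrt (R / 2)"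
    using KR pos by (auto simp: eventually_at_right_field intro!: exI[of _ "G * sqrt (R / 2)"])
  then have "\<forall>\<^sub>F \<epsilon> in at_right 0. \<exists>D\<ge>1. (\<forall>D'\<ge>D. err (\<epsilon> / G) D' \<le> ennreal ((\<epsilon> / G)\<^sup>2)) \<and>
      ereal (real D) \<le> max 1 (ereal 8 * (\<Delta> * ereal (K * R / (\<epsilon> / G) ^ 4))) \<and>
      ereal (real D) \<le> max 1 (ereal 8 * (\<Delta> * ereal (K * R * G ^ 4 / \<epsilon> ^ 4))) \<and>
      ereal (real (oracle_complexity D 1)) \<le> max 1 (ereal 8 * (\<Delta> * ereal (K * R * G ^ 4 / \<epsilon> ^ 4)))"
    by eventually_elim (use complexity in \<open>simp only: oracle_complexity_single rescale\<close>, blast)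
  with asymptotic show ?case
    unfolding Let_def err_def \<alpha>_def K_def[symmetric] R_def[symmetric] \<Delta>_def[symmetric] by blast
qed

end
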